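(* Let $N\ge1$, $p>1$, let $f$ be a nondecreasing, locally Lipschitz continuous function with $f(s)=0$ if and only if $s=0$, put $F(s)=\int_0^sf(\sigma)d\sigma$, and assume $$\int_1^\infty\frac{ds}{F(s)^{1/p}}=\infty .$$ Then for any $a>0$ there exists a unique solution $w=w_a$ of $$-(r^{N-1}|w_r|^{p-2}w_r)_r+r^{N-1}f(w)=0$$ defined on $[0,\infty)$ and satisfying $w(0)=a$, $w_r(0)=0$. It is given by $$w_a(r)=a+\int_0^rH_p\Big(s^{1-N}\int_0^s\tau^{N-1}f(w_a(\tau))\,d\tau\Big)ds ,$$ where $H_p$ is the inverse function of $t\mapsto|t|^{p-2}t$.
   Context: $f:\mathbb R\to\mathbb R$. A solution on $[0,\infty)$ is a function $w\in C^1([0,\infty))$ such that $r\mapsto r^{N-1}|w_r|^{p-2}w_r$ is $C^1$ on $(0,\infty)$ and the equation holds for $r>0$. *)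

theory Defs
  imports "HOL-Analysis.Analysis"
begin

text \<open>Functions on \<open>[0,\<infinity>)\<close> are total functions on the reals whose values on the negative axis are
  irrelevant: the derivative is taken within \<open>[0,\<infinity>)\<close>, hence one-sided at \<open>0\<close>.\<close>

definition half_deriv :: "(real \<Rightarrow> real) \<Rightarrow> real \<Rightarrow> real" where
  "half_deriv w r = vector_derivative w (at r within {0..})"

definition C1_half_line :: "(real \<Rightarrow> real) \<Rightarrow> bool" where
  "C1_half_line w \<longleftrightarrow> w differentiable_on {0..} \<and> continuous_on {0..} (half_deriv w)"

text \<open>Since \<open>0 powr x = 0\<close> and the factor \<open>t\<close> vanishes too, this takes the value \<open>0\<close> at \<open>t = 0\<close> for
  every \<open>p > 1\<close>, also when the exponent \<open>p - 2\<close> is negative.\<close>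

definition phi :: "real \<Rightarrow> real \<Rightarrow> real" where
  "phi p t = \<bar>t\<bar> powr (p - 2) * t"

definition H :: "real \<Rightarrow> real \<Rightarrow> real" where
  "H p = inv (phi p)"

definition primitive :: "(real \<Rightarrow> real) \<Rightarrow> real \<Rightarrow> real" where
  "primitive f s = (LBINT \<sigma>=0..ereal s. f \<sigma>)"

definition flux :: "real \<Rightarrow> real \<Rightarrow> (real \<Rightarrow> real) \<Rightarrow> real \<Rightarrow> real" where
  "flux N p w r = r powr (N - 1) * \<bar>half_deriv w r\<bar> powr (p - 2) * half_deriv w r"

definition radial_solution ::
    "real \<Rightarrow> real \<Rightarrow> (real \<Rightarrow> real) \<Rightarrow> (real \<Rightarrow> real) \<Rightarrow> bool" where
  "radial_solution N p f w \<longleftrightarrow>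
     C1_half_line w \<and>
     flux N p w C1_differentiable_on {0<..} \<and>
     (\<forall>r>0. - deriv (flux N p w) r + r powr (N - 1) * f (w r) = 0)"

end

theory Submission
  imports Defs
begin

text \<open>
  With the weighted mean \<open>m\<^sub>w(s) = s\<^bsup>1-N\<^esup> \<integral>\<^sub>0\<^sup>s \<tau>\<^bsup>N-1\<^esup> f(w(\<tau>)) d\<tau>\<close>, solutions are the fixed points of the
  operator \<open>w \<mapsto> a + \<integral>\<^sub>0\<^sup>r H\<^sub>p(m\<^sub>w(s)) ds\<close>, which is monotone in \<open>w\<close>. Nondecreasing functions
  between \<open>a\<close> and a supersolution \<open>U\<close> form a complete lattice, so the Knaster--Tarski argument yields a
  global fixed point without any continuation of local solutions. For \<open>U\<close> take the solution of
  \<open>U' = c F(U)\<^bsup>1/p\<^esup>\<close>, \<open>U(0) = a\<close>, with \<open>c\<^sup>p = p/(p-1)\<close>: it solves the one-dimensional equation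
  \<open>(U'\<^bsup>p-1\<^esup>)' = f(U)\<close>, the weight only decreases the mean, and the divergence of the
  Keller--Osserman integral says exactly that \<open>U\<close> never blows up.

  Conversely, the flux of a solution vanishes at \<open>0\<close> and increases as long as the solution is positive,
  so a solution stays above \<open>a\<close> and is a fixed point. Near \<open>0\<close> the function \<open>H\<^sub>p\<close> need not be Lipschitz,
  but \<open>m\<^sub>w(s)/s\<close> stays in a compact subset of \<open>(0,\<infinity>)\<close>, so differences of fixed points obey a Gronwall
  estimate; it is carried out in an exponentially weighted supremum norm.
\<close>

section \<open>The power law \<open>phi\<close> and its inverse \<open>H\<close> on nonnegative
  arguments\<close>

lemma phi_eq_sgn_powr:
  assumes "p > 1"
  shows "phi p t = sgn t * \<bar>t\<bar> powr (p - 1)"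
proof (cases "t = 0")
  case False
  have "\<bar>t\<bar> powr (p - 1) = \<bar>t\<bar> powr (p - 2) * \<bar>t\<bar>"
    using False powr_add[of "\<bar>t\<bar>" "p - 2" 1] by simp
  then show ?thesis
    by (simp add: phi_def abs_sgn mult.commute mult.left_commute sgn_mult_abs flip: mult.assoc)
qed (simp add: phi_def)

lemma phi_of_nonneg: "p > 1 \<Longrightarrow> t \<ge> 0 \<Longrightarrow> phi p t = t powr (p - 1)"
  by (simp add: phi_eq_sgn_powr sgn_if)

text \<open>The sign of \<open>phi p t\<close> recovers the sign of \<open>t\<close>, and its
  absolute value recovers that of \<open>t\<close> because the exponent \<open>p - 1\<close> is
  positive.\<close>

lemma inj_phi:
  assumes "p > 1"
  shows "inj (phi p)"
proof (rule injI)
  fix x y assume eq: "phi p x = phi p y"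
  have sg: "sgn (phi p t) = sgn t" for t
    using assms by (auto simp: phi_eq_sgn_powr sgn_mult sgn_if)
  have "sgn x = sgn y" using sg[of x] sg[of y] eq by simp
  moreover have "\<bar>phi p t\<bar> = \<bar>t\<bar> powr (p - 1)" for t
    using assms by (auto simp: phi_eq_sgn_powr abs_mult abs_sgn_eq)
  then have "\<bar>x\<bar> powr (p - 1) = \<bar>y\<bar> powr (p - 1)" using eq by metis
  then have "\<bar>x\<bar> = \<bar>y\<bar>"
    using assms by (metis abs_ge_zero powr_inj diff_gt_0_iff_gt less_irrefl powr_less_mono2 linorder_neqE)
  ultimately show "x = y" by (metis sgn_mult_abs)
qed

text \<open>As \<open>H p\<close> is given through \<open>inv\<close>, injectivity together with an
  explicit preimage settles its value. The means of admissible functions are nonnegative, so this is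
  the case that occurs.\<close>

lemma H_of_nonneg:
  assumes "p > 1" "y \<ge> 0"
  shows "H p y = y powr (1 / (p - 1))"
  unfolding H_def
proof (rule inv_f_eq[OF inj_phi[OF assms(1)]])
  show "phi p (y powr (1 / (p - 1))) = y"
    using assms by (simp add: phi_of_nonneg powr_powr)
qed

section \<open>Integrals and derivatives on the half-line\<close>

text \<open>Passes from the interval integrals of the theorem to gauge integrals. Continuity is
  asked for in the open interval: since \<open>0 powr 0 = 0\<close>, the weight
  \<open>\<tau> powr (N - 1)\<close> jumps at \<open>0\<close> when \<open>N = 1\<close>.\<close>

lemma interval_lebesgue_integral_eq_integral:
  fixes g :: "real \<Rightarrow> real"
  assumes "s \<ge> 0" "continuous_on {0<..<s} g" "\<And>x. x \<in> {0<..<s} \<Longrightarrow> \<bar>g x\<bar> \<le> B"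
  shows "(LBINT x=0..ereal s. g x) = integral {0..s} g"
proof -
  have "set_integrable lborel (einterval (ereal 0) (ereal s)) g"
    unfolding einterval_eq set_integrable_def
  proof (rule Bochner_Integration.integrable_bound[of _ "\<lambda>x. indicator {0<..<s} x *\<^sub>R B"])
    show "integrable lborel (\<lambda>x. indicator {0<..<s} x *\<^sub>R B)" using assms(1) by simp
    show "(\<lambda>x. indicator {0<..<s} x *\<^sub>R g x) \<in> borel_measurable lborel"
      using borel_measurable_continuous_on_indicator[OF _ assms(2)] by simp
    show "AE x in lborel. norm (indicator {0<..<s} x *\<^sub>R g x) \<le> norm (indicator {0<..<s} x *\<^sub>R B)"
      using assms(3) by (force simp: indicator_def)
  qed
  from interval_integral_eq_integral'[of "ereal 0" "ereal s", OF _ this] assms(1)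
  show ?thesis by (simp add: zero_ereal_def integral_open_interval_real)
qed

lemma continuous_on_halfline_if_interval:
  fixes h :: "real \<Rightarrow> real"
  assumes "\<And>R. R > b \<Longrightarrow> continuous_on {b..R} h"
  shows "continuous_on {b..} h"
proof -
  have "continuous (at x within {b..}) h" if "x \<ge> b" for x
  proof -
    have "continuous (at x within {b..x+1}) h"
      using assms[of "x+1"] that by (simp add: continuous_on_eq_continuous_within)
    moreover have "at x within {b..x+1} = at x within {b..}"
      by (rule at_within_nhd[of _ "{..<x+1}"]) auto
    ultimately show ?thesis by simp
  qed
  then show ?thesis by (simp add: continuous_on_eq_continuous_within)
qed

text \<open>The integrand may be irregular at \<open>b\<close>, as the weight is at \<open>0\<close>
  for \<open>N = 1\<close>. Splitting at the midpoint of \<open>b\<close> and \<open>t\<close>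
  leaves a constant plus the integral of a function continuous up to its end points.\<close>

lemma DERIV_integral_interior:
  fixes g :: "real \<Rightarrow> real"
  assumes "t > b" "continuous_on {b<..} g" "g integrable_on {b..t+1}"
  shows "((\<lambda>x. integral {b..x} g) has_real_derivative g t) (at t)"
proof -
  let ?c = "(b + t) / 2"
  have ct: "b < ?c" "?c < t" using assms by auto
  have "((\<lambda>x. integral {?c..x} g) has_real_derivative g t) (at t within {?c..t+1})"
    by (rule integral_has_real_derivative) (use ct in \<open>auto intro: continuous_on_subset[OF assms(2)]\<close>)
  then have "((\<lambda>x. integral {?c..x} g) has_real_derivative g t) (at t)"
    using at_within_interior[of t "{?c..t+1}"] ct by (simp add: interior_atLeastAtMost_real)
  then have "((\<lambda>x. integral {b..?c} g + integral {?c..x} g) has_real_derivative g t) (at t)"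
    by (auto intro!: derivative_eq_intros)
  then show ?thesis
  proof (rule DERIV_cong_ev[THEN iffD1, rotated -1], goal_cases)
    case 2
    have "\<forall>\<^sub>F x in nhds t. x \<in> {?c<..<t+1}"
      using ct by (intro eventually_nhds_in_open) auto
    then show ?case
    proof eventually_elim
      case (elim x)
      then show ?case using ct
        by (intro Henstock_Kurzweil_Integration.integral_combine integrable_subinterval_real[OF assms(3)]) auto
    qed
  qed simp_all
qed

text \<open>Makes derivatives within the half-line unique, at the end point \<open>0\<close> as
  well. A connected set that is not a singleton has no isolated point.\<close>

lemma at_within_halfline_neq_bot: "r \<ge> 0 \<Longrightarrow> at r within {0::real..} \<noteq> bot"
proof -
  assume r: "r \<ge> 0"
  have "{0::real..} \<noteq> {x}" for x
  proof
    assume "{0::real..} = {x}"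
    then have "0 \<in> {x}" "1 \<in> {x}" by (metis atLeast_iff order_refl zero_le_one)+
    then show False by simp
  qed
  then show ?thesis
    using connected_imp_perfect[of "{0::real..}" r] r by (simp add: trivial_limit_within)
qed

lemma half_deriv_eq:
  assumes "(w has_real_derivative d) (at r within {0..})" "r \<ge> 0"
  shows "half_deriv w r = d"
  unfolding half_deriv_def using assms at_within_halfline_neq_bot
  by (intro vector_derivative_within) (auto simp flip: has_real_derivative_iff_has_vector_derivative)

lemma flux_eq_phi: "flux N p w r = r powr (N - 1) * phi p (half_deriv w r)"
  by (simp add: flux_def phi_def mult.assoc)

text \<open>Mean value estimate with a derivative bounded on a compact interval. Positivity of
  \<open>c\<close> matters, since for \<open>0 < e < 1\<close> the derivative blows up at
  \<open>0\<close>.\<close>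

lemma Lipschitz_powr:
  fixes c C e :: real
  assumes "c > 0"
  obtains K where "K \<ge> 0"
    "\<And>x y. x \<in> {c..C} \<Longrightarrow> y \<in> {c..C} \<Longrightarrow> \<bar>x powr e - y powr e\<bar> \<le> K * \<bar>x - y\<bar>"
proof -
  have "continuous_on {c..C} (\<lambda>x. e * x powr (e - 1))"
    using assms by (intro continuous_intros) auto
  then have "compact ((\<lambda>x. e * x powr (e - 1)) ` {c..C})"
    by (rule compact_continuous_image) simp
  then obtain K where K: "\<And>x. x \<in> {c..C} \<Longrightarrow> \<bar>e * x powr (e - 1)\<bar> \<le> K"
    using compact_imp_bounded bounded_real by (metis (no_types, lifting) imageI)
  show ?thesis
  proof (rule that[of "max 0 K"])
    fix x y assume xy: "x \<in> {c..C}" "y \<in> {c..C}"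
    have "norm (x powr e - y powr e) \<le> max 0 K * norm (x - y)"
    proof (rule field_differentiable_bound[of "{c..C}" _ "\<lambda>x. e * x powr (e - 1)"])
      fix z assume "z \<in> {c..C}"
      then show "((\<lambda>x. x powr e) has_field_derivative e * z powr (e - 1)) (at z within {c..C})"
        using assms by (auto intro!: derivative_eq_intros simp: powr_diff)
      show "norm (e * z powr (e - 1)) \<le> max 0 K" using K[OF \<open>z \<in> _\<close>] by auto
    qed (use xy in auto)
    then show "\<bar>x powr e - y powr e\<bar> \<le> max 0 K * \<bar>x - y\<bar>" by simp
  qed simp
qed

section \<open>The monotone operator \<open>picard\<close> on admissible functions\<close>

locale radial_data =
  fixes N p a :: real and f :: "real \<Rightarrow> real"
  assumes N1: "N \<ge> 1" and p1: "p > 1" and monof: "mono f"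
    and lip: "local_lipschitz (UNIV :: real set) UNIV (\<lambda>_. f)"
    and f0: "f s = 0 \<longleftrightarrow> s = 0"
    and a0: "a > 0"
begin

text \<open>The exponent of \<open>H p\<close> on nonnegative arguments.\<close>

definition "q = 1 / (p - 1)"

definition "weighted_integral w s = integral {0..s} (\<lambda>\<tau>. \<tau> powr (N - 1) * f (w \<tau>))"

definition "mean w s = s powr (1 - N) * weighted_integral w s"

definition "picard w r = a + integral {0..r} (\<lambda>s. mean w s powr q)"

text \<open>Monotonicity takes the place of continuity: it already makes the weighted integrands
  integrable, and unlike continuity it survives pointwise suprema. The lower bound keeps
  \<open>f (w r)\<close> at or above \<open>f a > 0\<close>.\<close>

definition admissible :: "(real \<Rightarrow> real) \<Rightarrow> bool" where
  "admissible w \<longleftrightarrow> mono_on {0..} w \<and> (\<forall>r\<ge>0. a \<le> w r)"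

lemma q_pos: "q > 0" using p1 by (simp add: q_def)

lemma cont_f: "continuous_on A f"
  using local_lipschitz_continuous_on[OF lip, of 0] continuous_on_subset by blast

lemma f_mono: "x \<le> y \<Longrightarrow> f x \<le> f y" using monof by (rule monoD)

lemma f_pos: "x > 0 \<Longrightarrow> f x > 0"
  using f_mono[of 0 x] f0[of 0] f0[of x] by linarith

lemma f_admissible_ge: "admissible w \<Longrightarrow> r \<ge> 0 \<Longrightarrow> f a \<le> f (w r)"
  by (simp add: admissible_def f_mono)

lemma f_admissible_pos: "admissible w \<Longrightarrow> r \<ge> 0 \<Longrightarrow> f (w r) > 0"
  using f_admissible_ge[of w r] f_pos[OF a0] by linarith

lemma f_admissible_mono: "admissible w \<Longrightarrow> 0 \<le> x \<Longrightarrow> x \<le> y \<Longrightarrow> f (w x) \<le> f (w y)"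
  unfolding admissible_def by (intro f_mono mono_onD[of "{0..}" w x y]) auto

text \<open>A product of nonnegative nondecreasing factors is nondecreasing, hence
  integrable.\<close>

lemma integrable_weight:
  assumes "admissible w"
  shows "(\<lambda>\<tau>. \<tau> powr (N - 1) * f (w \<tau>)) integrable_on {0..s}"
  using N1
  by (intro integrable_on_mono_on mono_onI mult_mono powr_mono2 f_admissible_mono[OF assms])
     (auto intro: f_admissible_pos[OF assms] less_imp_le)

lemma weighted_integral_upper:
  assumes "admissible w" "s \<ge> 0"
  shows "weighted_integral w s \<le> s powr N * f (w s)"
proof -
  have "weighted_integral w s \<le> integral {0..s} (\<lambda>\<tau>. s powr (N - 1) * f (w s))"
    unfolding weighted_integral_def
    by (intro integral_le integrable_weight assms mult_mono powr_mono2 f_admissible_mono[OF assms(1)])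
       (use N1 in \<open>auto intro: f_admissible_pos[OF assms(1)] less_imp_le\<close>)
  also have "\<dots> = s powr N * f (w s)"
    using assms(2) powr_add[of s "N-1" 1] by (cases "s = 0") auto
  finally show ?thesis .
qed

text \<open>Replacing \<open>f (w \<tau>)\<close> by its lower bound \<open>f a\<close> leaves a
  power whose integral is explicit; the factor \<open>1 / N\<close> comes from there.\<close>

lemma weighted_integral_lower:
  assumes "admissible w" "s \<ge> 0"
  shows "s powr N * (f a / N) \<le> weighted_integral w s"
proof -
  have *: "((\<lambda>\<tau>. \<tau> powr (N - 1) * f a) has_integral (s powr N / N * f a)) {0..s}"
    using has_integral_mult_left[OF has_integral_powr_from_0[of "N - 1" s], of "f a"] N1 assms(2) by simp
  have "s powr N * (f a / N) = integral {0..s} (\<lambda>\<tau>. \<tau> powr (N - 1) * f a)"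
    using integral_unique[OF *] by simp
  also have "\<dots> \<le> weighted_integral w s"
    unfolding weighted_integral_def using *
    by (intro integral_le integrable_weight[OF assms(1)] mult_left_mono f_admissible_ge[OF assms(1)]) auto
  finally show ?thesis .
qed

lemma powr_cancel_N: "s \<ge> 0 \<Longrightarrow> s powr (1 - N) * s powr N = s"
  by (cases "s = 0") (auto simp flip: powr_add)

text \<open>Together with \<open>mean_lower\<close> this makes the mean comparable to
  \<open>s\<close>, which yields continuity at \<open>0\<close> and the compact range behind
  uniqueness.\<close>

lemma mean_upper:
  assumes "admissible w" "s \<ge> 0"
  shows "mean w s \<le> s * f (w s)"
  using mult_left_mono[OF weighted_integral_upper[OF assms], of "s powr (1 - N)"] powr_cancel_N[OF assms(2)]
  by (simp add: mean_def flip: mult.assoc)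

lemma mean_lower:
  assumes "admissible w" "s \<ge> 0"
  shows "s * (f a / N) \<le> mean w s"
  using mult_left_mono[OF weighted_integral_lower[OF assms], of "s powr (1 - N)"] powr_cancel_N[OF assms(2)]
  by (simp add: mean_def flip: mult.assoc)

lemma mean_nonneg: "admissible w \<Longrightarrow> s \<ge> 0 \<Longrightarrow> 0 \<le> mean w s"
  using order_trans[OF _ mean_lower[of w s], of 0] f_pos[OF a0] N1 by simp

text \<open>The junk value \<open>0 powr (1 - N) = 0\<close> makes the mean continuous at \<open>0\<close>.\<close>

lemma mean_at_0: "mean w 0 = 0" by (simp add: mean_def)

lemma mean_mono:
  assumes "admissible v" "admissible w" "s \<ge> 0" "\<And>r. 0 \<le> r \<Longrightarrow> r \<le> s \<Longrightarrow> v r \<le> w r"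
  shows "mean v s \<le> mean w s"
  unfolding mean_def weighted_integral_def
  by (intro mult_left_mono integral_le integrable_weight assms f_mono) auto

text \<open>An admissible function may jump, but its weighted integral is continuous. At
  \<open>0\<close> the mean is squeezed between \<open>0\<close> and a multiple of
  \<open>s\<close>.\<close>

lemma continuous_mean:
  assumes "admissible w"
  shows "continuous_on {0..} (mean w)"
proof (rule continuous_on_halfline_if_interval)
  fix R :: real assume "R > 0"
  have "continuous (at s within {0..R}) (mean w)" if s: "s \<in> {0..R}" for s
  proof (cases "s = 0")
    case False
    have "continuous_on {0..R} (weighted_integral w)"
      unfolding weighted_integral_def by (intro indefinite_integral_continuous_1 integrable_weight assms)
    then have "continuous (at s within {0..R}) (weighted_integral w)"
      using s by (simp add: continuous_on_eq_continuous_within)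
    then show ?thesis
      unfolding mean_def using False s
      by (intro continuous_intros) auto
  next
    case True
    have "(mean w \<longlongrightarrow> 0) (at 0 within {0..R})"
    proof (rule tendsto_sandwich[of "\<lambda>_. 0" _ _ "\<lambda>s. s * f (w R)"])
      show "\<forall>\<^sub>F x in at 0 within {0..R}. 0 \<le> mean w x"
        by (auto simp: eventually_at_filter mean_nonneg[OF assms])
      have "mean w x \<le> x * f (w R)" if "x \<in> {0..R}" for x
        using mean_upper[OF assms, of x] f_admissible_mono[OF assms, of x R] that
        by (meson atLeastAtMost_iff mult_left_mono order_trans)
      then show "\<forall>\<^sub>F x in at 0 within {0..R}. mean w x \<le> x * f (w R)"
        by (auto simp: eventually_at_filter)
      show "((\<lambda>s. s * f (w R)) \<longlongrightarrow> 0) (at 0 within {0..R})"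
        by (auto intro!: tendsto_eq_intros)
    qed simp
    then show ?thesis by (simp add: continuous_within True mean_at_0)
  qed
  then show "continuous_on {0..R} (mean w)" by (simp add: continuous_on_eq_continuous_within)
qed

lemma continuous_slope:
  assumes "admissible w"
  shows "continuous_on {0..} (\<lambda>s. mean w s powr q)"
  using q_pos mean_nonneg[OF assms]
  by (intro continuous_on_powr' continuous_mean assms continuous_on_const) auto

lemma integrable_slope:
  assumes "admissible w" "s \<ge> 0"
  shows "(\<lambda>s. mean w s powr q) integrable_on {s..r}"
  by (rule integrable_continuous_real, rule continuous_on_subset[OF continuous_slope[OF assms(1)]])
     (use assms in auto)

lemma picard_mono:
  assumes "admissible v" "admissible w" "r \<ge> 0" "\<And>s. 0 \<le> s \<Longrightarrow> s \<le> r \<Longrightarrow> v s \<le> w s"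
  shows "picard v r \<le> picard w r"
  unfolding picard_def using q_pos assms
  by (auto intro!: integral_le integrable_slope powr_mono2 mean_mono mean_nonneg)

lemma admissible_picard:
  assumes "admissible w"
  shows "admissible (picard w)"
proof -
  have "picard w x \<le> picard w y" if "0 \<le> x" "x \<le> y" for x y
    unfolding picard_def using that
    by (auto intro!: integral_subset_le integrable_slope assms)
  moreover have "picard w 0 = a" by (simp add: picard_def)
  ultimately show ?thesis unfolding admissible_def mono_on_def by (metis atLeast_iff order_refl)
qed

lemma has_derivative_picard:
  assumes "admissible w" "r \<ge> 0"
  shows "(picard w has_real_derivative (mean w r powr q)) (at r within {0..})"
proof -
  \<comment> \<open>The interval reaches past \<open>r\<close>, so that near \<open>r\<close> it
    agrees with the half-line.\<close>
  have "((\<lambda>r. integral {0..r} (\<lambda>s. mean w s powr q)) has_real_derivative mean w r powr q) (at r within {0..r+1})"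
    by (rule integral_has_real_derivative)
       (use assms(2) in \<open>auto intro: continuous_on_subset[OF continuous_slope[OF assms(1)]]\<close>)
  moreover have "at r within {0..r+1} = at r within {0..}"
    by (rule at_within_nhd[of _ "{..<r+1}"]) auto
  ultimately show ?thesis unfolding picard_def by (auto intro!: derivative_eq_intros)
qed

section \<open>A fixed point below a supersolution\<close>

lemma ex_fixed_point:
  assumes "admissible U" "\<And>r. r \<ge> 0 \<Longrightarrow> picard U r \<le> U r"
  shows "\<exists>w. admissible w \<and> (\<forall>r\<ge>0. w r = picard w r)"
proof -
  \<comment> \<open>The members of \<open>S\<close> are subsolutions below \<open>U\<close>: they
    lie below their own image. Their pointwise supremum is the candidate.\<close>
  define S where "S = {w. admissible w \<and> (\<forall>r\<ge>0. w r \<le> U r) \<and> (\<forall>r\<ge>0. w r \<le> picard w r)}"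
  define w where "w r = (SUP u\<in>S. u r)" for r
  have adm_a: "admissible (\<lambda>_. a)" by (simp add: admissible_def mono_on_def)
  \<comment> \<open>Images under \<open>picard\<close> are at least \<open>a\<close>, so the
    constant is a subsolution. Hence the supremum is taken over a nonempty set and is itself at
    least \<open>a\<close>.\<close>
  have aS: "(\<lambda>_. a) \<in> S"
    using admissible_picard[OF adm_a] assms(1) by (auto simp: S_def adm_a) (auto simp: admissible_def)
  have bdd: "bdd_above ((\<lambda>u. u r) ` S)" if "r \<ge> 0" for r
    using that by (auto simp: bdd_above_def S_def)
  have up: "u r \<le> w r" if "u \<in> S" "r \<ge> 0" for u r
    unfolding w_def by (rule cSUP_upper[OF that(1) bdd[OF that(2)]])
  have least: "w r \<le> B" if "\<And>u. u \<in> S \<Longrightarrow> u r \<le> B" for r B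
    unfolding w_def using aS that by (intro cSUP_least) auto
  have "w x \<le> w y" if "0 \<le> x" "x \<le> y" for x y
  proof (rule least)
    fix u assume u: "u \<in> S"
    then have "u x \<le> u y" using that by (auto simp: S_def admissible_def mono_on_def)
    also have "\<dots> \<le> w y" using up[OF u] that by simp
    finally show "u x \<le> w y" .
  qed
  then have adm_w: "admissible w" using up[OF aS] by (auto simp: admissible_def mono_on_def)
  have w_le_picard: "w r \<le> picard w r" if "r \<ge> 0" for r
  proof (rule least)
    fix u assume u: "u \<in> S"
    then have "u r \<le> picard u r" using that by (simp add: S_def)
    also have "\<dots> \<le> picard w r" by (rule picard_mono) (use u up that adm_w S_def in auto)
    finally show "u r \<le> picard w r" .
  qed
  have wU: "w r \<le> U r" if "r \<ge> 0" for r by (rule least) (use that S_def in auto)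
  have "picard w r \<le> U r" if "r \<ge> 0" for r
    using picard_mono[OF adm_w assms(1) that wU] assms(2)[OF that] by simp
  moreover have "picard w r \<le> picard (picard w) r" if "r \<ge> 0" for r
    by (rule picard_mono[OF adm_w admissible_picard[OF adm_w] that w_le_picard])
  \<comment> \<open>The image of \<open>w\<close> belongs to \<open>S\<close> again and therefore
    lies below the supremum \<open>w\<close>, which is the missing inequality.\<close>
  ultimately have "picard w \<in> S" by (simp add: S_def admissible_picard[OF adm_w])
  then have "picard w r \<le> w r" if "r \<ge> 0" for r using up that by blast
  then show ?thesis using adm_w w_le_picard by (intro exI[of _ w]) (auto intro: antisym)
qed

section \<open>Uniqueness of the fixed point\<close>

text \<open>\<open>local_lipschitz\<close> speaks of families depending on a parameter; freezing the
  parameter at \<open>0\<close> and restricting to a compact interval gives one constant.\<close>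

lemma Lipschitz_f:
  obtains L where "L \<ge> 0" "\<And>x y. x \<in> {A..B} \<Longrightarrow> y \<in> {A..B} \<Longrightarrow> \<bar>f x - f y\<bar> \<le> L * \<bar>x - y\<bar>"
proof -
  have "local_lipschitz {0::real} {A..B} (\<lambda>_. f)"
    by (rule local_lipschitz_subset[OF lip]) auto
  from local_lipschitz_compact_implies_lipschitz[OF this] obtain L where L: "L-lipschitz_on {A..B} f"
    by auto
  show ?thesis
    by (rule that[of L]) (use lipschitz_onD[OF L] lipschitz_on_nonneg[OF L] in \<open>auto simp: dist_real_def\<close>)
qed

lemma fixed_point_continuous:
  assumes "admissible w" "\<And>r. r \<ge> 0 \<Longrightarrow> w r = picard w r"
  shows "continuous_on {0..} w"
proof -
  have "continuous_on {0..} (picard w)"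
    by (rule DERIV_continuous_on[OF has_derivative_picard[OF assms(1)]]) auto
  then show ?thesis by (rule continuous_on_eq) (use assms(2) in auto)
qed

text \<open>The powers of \<open>s\<close> cancel up to one factor \<open>s\<close>; this factor
  pays for the later division of the means by \<open>s\<close>.\<close>

lemma mean_diff_le:
  assumes "admissible v" "admissible w" "s \<ge> 0"
    and B: "\<And>r. 0 \<le> r \<Longrightarrow> r \<le> s \<Longrightarrow> \<bar>f (v r) - f (w r)\<bar> \<le> B"
  shows "\<bar>mean v s - mean w s\<bar> \<le> s * B"
proof -
  have B0: "B \<ge> 0" using B[of s] assms(3) by auto
  let ?h = "\<lambda>\<tau>. \<tau> powr (N - 1) * f (v \<tau>) - \<tau> powr (N - 1) * f (w \<tau>)"
  have int: "?h integrable_on {0..s}"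
    by (intro integrable_diff integrable_weight assms)
  have "norm (integral {0..s} ?h) \<le> integral {0..s} (\<lambda>_. s powr (N - 1) * B)"
  proof (rule integral_norm_bound_integral[OF int])
    fix x assume x: "x \<in> {0..s}"
    have "norm (?h x) = x powr (N - 1) * \<bar>f (v x) - f (w x)\<bar>"
      by (simp add: abs_mult flip: right_diff_distrib)
    also have "\<dots> \<le> s powr (N - 1) * B"
      using x N1 B[of x] by (intro mult_mono powr_mono2) auto
    finally show "norm (?h x) \<le> s powr (N - 1) * B" .
  qed auto
  also have "\<dots> = s powr N * B"
    using assms(3) powr_add[of s "N-1" 1] by (cases "s = 0") auto
  finally have "\<bar>weighted_integral v s - weighted_integral w s\<bar> \<le> s powr N * B"
    by (simp add: weighted_integral_def integral_diff integrable_weight assms)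
  then have "s powr (1 - N) * \<bar>weighted_integral v s - weighted_integral w s\<bar> \<le> s powr (1 - N) * (s powr N * B)"
    by (rule mult_left_mono) simp
  also have "\<dots> = s * B" using powr_cancel_N[OF assms(3)] by (simp flip: mult.assoc)
  also have "s powr (1 - N) * \<bar>weighted_integral v s - weighted_integral w s\<bar> = \<bar>mean v s - mean w s\<bar>"
    by (simp add: mean_def abs_mult flip: right_diff_distrib)
  finally show ?thesis .
qed

text \<open>The difference is measured by the maximum \<open>m\<close> of
  \<open>\<bar>v r - w r\<bar>\<close> times \<open>exp (- l * r)\<close> over
  \<open>{0..R}\<close>. The integral equation gives \<open>m \<le> m / 2\<close>, so
  \<open>m\<close> vanishes.\<close>

lemma fixed_point_unique:
  assumes "admissible v" "\<And>r. r \<ge> 0 \<Longrightarrow> v r = picard v r"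
    and "admissible w" "\<And>r. r \<ge> 0 \<Longrightarrow> w r = picard w r" and "R \<ge> 0"
  shows "v R = w R"
proof -
  note admissible = assms(1,3)
  define M where "M = max (v R) (w R)"
  have rng: "v r \<in> {a..M}" "w r \<in> {a..M}" if "r \<in> {0..R}" for r
    using admissible that unfolding M_def admissible_def mono_on_def by (force simp: le_max_iff_disj)+
  obtain L where L: "L \<ge> 0" "\<And>x y. x \<in> {a..M} \<Longrightarrow> y \<in> {a..M} \<Longrightarrow> \<bar>f x - f y\<bar> \<le> L * \<bar>x - y\<bar>"
    using Lipschitz_f[of a M] by blast
  have "f a / N > 0" using f_pos[OF a0] N1 by simp
  then obtain K where K: "K \<ge> 0" "\<And>x y. x \<in> {f a / N..f M} \<Longrightarrow> y \<in> {f a / N..f M} \<Longrightarrow>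
      \<bar>x powr q - y powr q\<bar> \<le> K * \<bar>x - y\<bar>"
    using Lipschitz_powr[of "f a / N" "f M" q] by blast
  \<comment> \<open>The slopes \<open>mean u s powr q\<close> inherit the constants \<open>L\<close>
    of \<open>f\<close> and \<open>K\<close> of the power; \<open>R powr q\<close> bounds the factor
    split off below, and the summand \<open>1\<close> keeps \<open>k\<close> positive.\<close>
  define k where "k = K * R powr q * L + 1"
  have k: "k > 0" using K(1) L(1) by (simp add: k_def add_nonneg_pos)
  \<comment> \<open>Integrating \<open>k * exp (l * s)\<close> produces the factor
    \<open>k / l\<close>, here \<open>1 / 2\<close>.\<close>
  define l where "l = 2 * k"
  let ?D = "\<lambda>r. exp (- l * r) * \<bar>v r - w r\<bar>"
  have "continuous_on {0..R} ?D"
    using continuous_on_subset[OF fixed_point_continuous[OF assms(1,2)], of "{0..R}"]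
      continuous_on_subset[OF fixed_point_continuous[OF assms(3,4)], of "{0..R}"]
    by (auto intro!: continuous_intros)
  then obtain r0 where r0: "r0 \<in> {0..R}" "\<And>r. r \<in> {0..R} \<Longrightarrow> ?D r \<le> ?D r0"
    using continuous_attains_sup[of "{0..R}" ?D] assms(5) by auto
  define m where "m = ?D r0"
  have m0: "m \<ge> 0" by (simp add: m_def)
  have vw: "\<bar>v r - w r\<bar> \<le> m * exp (l * r)" if "r \<in> {0..R}" for r
  proof -
    have "\<bar>v r - w r\<bar> = ?D r * exp (l * r)" by (simp add: exp_minus field_simps)
    also have "\<dots> \<le> m * exp (l * r)"
      using r0(2)[OF that] unfolding m_def by (rule mult_right_mono) simp
    finally show ?thesis .
  qed
  have slope: "\<bar>mean v s powr q - mean w s powr q\<bar> \<le> k * m * exp (l * s)" if s: "s \<in> {0..R}" for s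
  proof (cases "s = 0")
    case False
    then have sp: "s > 0" using s by simp
    have "\<bar>f (v r) - f (w r)\<bar> \<le> L * (m * exp (l * s))" if r: "0 \<le> r" "r \<le> s" for r
    proof -
      have "r \<in> {0..R}" using r s by auto
      then have "\<bar>f (v r) - f (w r)\<bar> \<le> L * \<bar>v r - w r\<bar>" using rng by (intro L(2)) auto
      also have "\<dots> \<le> L * (m * exp (l * r))" using vw[OF \<open>r \<in> _\<close>] L(1) by (rule mult_left_mono)
      also have "\<dots> \<le> L * (m * exp (l * s))"
        using r k L(1) m0 by (intro mult_left_mono) (auto simp: l_def)
      finally show ?thesis .
    qed
    from mean_diff_le[OF admissible _ this] sp
    have md: "\<bar>mean v s - mean w s\<bar> \<le> s * (L * (m * exp (l * s)))" by simp
    have quot: "mean u s / s \<in> {f a / N..f M}" if "admissible u" "u s \<le> M" for u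
    proof -
      have "f (u s) \<le> f M" using that(2) by (rule f_mono)
      then have "s * f (u s) \<le> s * f M" using sp by (intro mult_left_mono) auto
      with mean_upper[OF that(1), of s] mean_lower[OF that(1), of s] sp
      have "s * (f a / N) \<le> mean u s" "mean u s \<le> s * f M" by linarith+
      then show ?thesis using sp by (simp add: le_divide_eq divide_le_eq mult.commute)
    qed
    \<comment> \<open>After \<open>s powr q\<close> is split off, the remaining argument lies in a
      compact interval away from \<open>0\<close>, where the power is Lipschitz even if
      \<open>q < 1\<close>.\<close>
    have split: "mean u s powr q = s powr q * (mean u s / s) powr q" if "admissible u" for u
      using sp mean_nonneg[OF that, of s] by (simp flip: powr_mult)
    have "\<bar>mean v s powr q - mean w s powr q\<bar> = s powr q * \<bar>(mean v s / s) powr q - (mean w s / s) powr q\<bar>"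
      unfolding split[OF admissible(1)] split[OF admissible(2)] by (simp add: abs_mult flip: right_diff_distrib)
    also have "\<dots> \<le> s powr q * (K * \<bar>mean v s / s - mean w s / s\<bar>)"
      using rng[OF s] by (intro mult_left_mono K(2) quot admissible) auto
    also have "\<bar>mean v s / s - mean w s / s\<bar> = \<bar>mean v s - mean w s\<bar> / s"
      using sp by (simp flip: diff_divide_distrib)
    also have "\<dots> \<le> L * (m * exp (l * s))"
      using md sp by (simp add: divide_le_eq mult.commute)
    also have "s powr q * (K * (L * (m * exp (l * s)))) \<le> R powr q * (K * (L * (m * exp (l * s))))"
      using sp s q_pos K(1) L(1) m0 by (intro mult_right_mono powr_mono2) auto
    also have "\<dots> \<le> k * m * exp (l * s)"
      using m0 by (simp add: k_def algebra_simps)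
    finally show ?thesis using K(1) sp by (simp add: mult_left_mono)
  qed (use k m0 in \<open>simp add: mean_at_0\<close>)
  have r00: "0 \<le> r0" using r0 by simp
  have ex: "((\<lambda>s. k * m * exp (l * s)) has_integral (m / 2 * exp (l * r0) - m / 2 * exp (l * 0))) {0..r0}"
    using k r00 by (intro fundamental_theorem_of_calculus)
      (auto intro!: derivative_eq_intros simp: l_def simp flip: has_real_derivative_iff_has_vector_derivative)
  have "\<bar>v r0 - w r0\<bar> = \<bar>integral {0..r0} (\<lambda>s. mean v s powr q - mean w s powr q)\<bar>"
    using assms(2,4)[OF r00] by (simp add: picard_def integral_diff integrable_slope admissible)
  also have "\<dots> \<le> integral {0..r0} (\<lambda>s. k * m * exp (l * s))"
    unfolding real_norm_def[symmetric]
    using slope r0(1) ex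
    by (intro integral_norm_bound_integral integrable_diff integrable_slope admissible) auto
  also have "\<dots> \<le> m / 2 * exp (l * r0)"
    using integral_unique[OF ex] m0 by simp
  finally have "m \<le> exp (- l * r0) * (m / 2 * exp (l * r0))"
    unfolding m_def by (rule mult_left_mono) simp
  also have "\<dots> = m / 2" by (simp add: exp_minus field_simps)
  finally have "m \<le> m / 2" .
  then show ?thesis using vw[of R] m0 assms(5) by simp
qed

section \<open>The primitive of \<open>f\<close> and the construction of the supersolution\<close>

lemma primitive_eq: "s \<ge> 0 \<Longrightarrow> primitive f s = integral {0..s} f"
  using interval_integral_eq_integral[OF _ borel_integrable_atLeastAtMost'[OF cont_f], of 0 s]
  by (simp add: primitive_def zero_ereal_def)

lemma f_integrable: "f integrable_on {x..y}"
  by (rule integrable_continuous_real[OF cont_f])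

lemma f_nonneg: "x \<ge> 0 \<Longrightarrow> f x \<ge> 0"
  using f_mono[of 0 x] f0[of 0] by simp

lemma DERIV_primitive:
  assumes "s > 0"
  shows "(primitive f has_real_derivative f s) (at s)"
proof (rule has_field_derivative_transform_within_open)
  show "((\<lambda>s. integral {0..s} f) has_real_derivative f s) (at s)"
    by (rule DERIV_integral_interior[OF assms cont_f f_integrable])
qed (use assms in \<open>auto simp: primitive_eq intro: open_greaterThan[of 0]\<close>)

text \<open>As \<open>f\<close> vanishes at \<open>0\<close>, the lower bound is taken from the
  right half of the interval, where \<open>f\<close> is at least
  \<open>f (s / 2) > 0\<close>.\<close>

lemma primitive_pos:
  assumes "s > 0"
  shows "primitive f s > 0"
proof -
  have "0 < s / 2 * f (s / 2)" using assms f_pos by simp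
  also have "\<dots> = integral {s/2..s} (\<lambda>_. f (s / 2))" using assms by simp
  also have "\<dots> \<le> integral {s/2..s} f" by (intro integral_le f_integrable f_mono) auto
  also have "\<dots> \<le> integral {0..s} f"
    using assms by (intro integral_subset_le f_integrable) (auto intro: f_nonneg)
  finally show ?thesis using assms by (simp add: primitive_eq)
qed

text \<open>Up to a constant, \<open>\<Theta> s\<close> is the time at which the solution of
  \<open>U' = c F(U)^(1/p)\<close> reaches level \<open>s\<close>. Unboundedness means that no level
  at infinity is reached in finite time.\<close>

lemma ex_unbounded_travel_time:
  assumes div: "(\<integral>\<^sup>+s\<in>{1..}. ennreal (1 / primitive f s powr (1 / p)) \<partial>lborel) = \<infinity>"
    and "c > 0"
  obtains \<Theta> :: "real \<Rightarrow> real"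
  where "\<And>s. s \<ge> a \<Longrightarrow> (\<Theta> has_real_derivative 1 / (c * primitive f s powr (1 / p))) (at s)"
    and "\<And>B. \<exists>s\<ge>a. \<Theta> s > B"
proof -
  \<comment> \<open>Lying strictly below both \<open>a\<close> and \<open>1\<close>, this base point
    gives two-sided derivatives from \<open>a\<close> on and from \<open>1\<close> on, and its
    positivity keeps the primitive away from \<open>0\<close>.\<close>
  define b where "b = min a 1 / 2"
  have b: "0 < b" "b < a" "b < 1" using a0 by (auto simp: b_def)
  \<comment> \<open>The maximum extends the integrand to a continuous positive function on the whole
    line.\<close>
  define h where "h x = 1 / (c * primitive f (max b x) powr (1 / p))" for x
  have cont_F: "continuous_on {0<..} (primitive f)"
    by (rule DERIV_continuous_on) (auto intro: has_field_derivative_at_within DERIV_primitive)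
  have contF': "continuous_on UNIV (\<lambda>x. primitive f (max b x))"
    by (rule continuous_on_compose2[OF cont_F]) (use b in \<open>auto intro!: continuous_intros\<close>)
  have Fpos: "primitive f (max b x) > 0" for x using b by (intro primitive_pos) auto
  then have cont_h: "continuous_on UNIV h"
    unfolding h_def using assms(2)
    by (intro continuous_intros contF') (auto simp: less_imp_neq[symmetric])
  have hpos: "h x > 0" for x using Fpos[of x] assms(2) by (simp add: h_def)
  define \<Theta> where "\<Theta> s = integral {b..s} h" for s
  have der: "(\<Theta> has_real_derivative h s) (at s)" if "s > b" for s
    unfolding \<Theta>_def
    by (rule DERIV_integral_interior[OF that])
       (auto intro: continuous_on_subset[OF cont_h] integrable_continuous_real)
  have h_eq: "h s = 1 / (c * primitive f s powr (1 / p))" if "s \<ge> b" for s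
    using that by (simp add: h_def max_def)
  have mono: "\<Theta> x \<le> \<Theta> y" if "x \<le> y" for x y
    unfolding \<Theta>_def
  proof (rule integral_subset_le)
    show "h integrable_on {b..x}" "h integrable_on {b..y}"
      by (intro integrable_continuous_real continuous_on_subset[OF cont_h] subset_UNIV)+
  qed (use hpos that in \<open>auto simp: less_imp_le\<close>)
  \<comment> \<open>If bounded, the nondecreasing \<open>\<Theta>\<close> would converge, and the
    fundamental theorem on \<open>{1..}\<close> would give the divergent integral a finite
    value.\<close>
  have unbdd: "\<exists>s\<ge>a. \<Theta> s > B" for B
  proof (rule ccontr)
    assume "\<not> ?thesis"
    then have B: "\<Theta> s \<le> B" if "s \<ge> a" for s using that by force
    have B': "\<Theta> s \<le> B" for s using mono[of s "max s a"] B[of "max s a"] by simp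
    then have bdd: "bdd_above (range \<Theta>)" by (auto simp: bdd_above_def)
    have "(\<Theta> \<longlongrightarrow> (SUP s. \<Theta> s)) at_top"
    proof (rule increasing_tendsto)
      show "\<forall>\<^sub>F s in at_top. \<Theta> s \<le> (SUP s. \<Theta> s)"
        using cSUP_upper[OF _ bdd] by (auto intro: always_eventually)
      fix x assume "x < (SUP s. \<Theta> s)"
      then obtain s where "x < \<Theta> s" using less_cSUP_iff[OF _ bdd] by auto
      then show "\<forall>\<^sub>F s in at_top. x < \<Theta> s"
        using mono by (auto simp: eventually_at_top_linorder intro: less_le_trans)
    qed
    then have lim: "((\<lambda>s. c * \<Theta> s) \<longlongrightarrow> c * (SUP s. \<Theta> s)) at_top"
      by (intro tendsto_intros)
    have "(\<integral>\<^sup>+s. ennreal (c * h s) * indicator {1..} s \<partial>lborel) = ennreal (c * (SUP s. \<Theta> s) - c * \<Theta> 1)"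
    proof (rule nn_integral_FTC_atLeast[OF _ _ _ lim])
      show "(\<lambda>s. c * h s) \<in> borel_measurable borel"
        by (intro borel_measurable_continuous_onI continuous_intros cont_h)
      show "((\<lambda>s. c * \<Theta> s) has_real_derivative c * h x) (at x)" if "1 \<le> x" for x
        using that b by (intro DERIV_cmult der) auto
    qed (use hpos assms(2) in \<open>auto simp: less_imp_le\<close>)
    moreover have "(\<integral>\<^sup>+s. ennreal (c * h s) * indicator {1..} s \<partial>lborel) = \<infinity>"
    proof -
      have "ennreal (c * h s) * indicator {1..} s = ennreal (1 / primitive f s powr (1 / p)) * indicator {1..} s"
        for s using b assms(2) h_eq[of s] by (cases "s \<ge> 1") auto
      then show ?thesis using div by simp
    qed
    ultimately show False by simp
  qed
  show ?thesis by (rule that[of \<Theta>]) (use der h_eq b unbdd in auto)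
qed

lemma ex_supersolution:
  assumes div: "(\<integral>\<^sup>+s\<in>{1..}. ennreal (1 / primitive f s powr (1 / p)) \<partial>lborel) = \<infinity>"
  shows "\<exists>U. admissible U \<and> (\<forall>r\<ge>0. picard U r \<le> U r)"
proof -
  define c where "c = (p / (p - 1)) powr (1 / p)"
  have c: "c > 0" "c powr p = p / (p - 1)" using p1 by (auto simp: c_def powr_powr)
  let ?F = "primitive f"
  \<comment> \<open>\<open>V s\<close> is the speed of \<open>U\<close> at level
    \<open>s\<close>.\<close>
  define V where "V s = c * ?F s powr (1 / p)" for s
  obtain \<Theta> where der: "\<And>s. s \<ge> a \<Longrightarrow> (\<Theta> has_real_derivative 1 / V s) (at s)"
    and unbdd: "\<And>B. \<exists>s\<ge>a. \<Theta> s > B"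
    using ex_unbounded_travel_time[OF div c(1)] unfolding V_def by blast
  have Vpos: "V s > 0" if "s \<ge> a" for s using primitive_pos[of s] that a0 c by (simp add: V_def)
  \<comment> \<open>Normalised to vanish at \<open>a\<close>, so that its inverse \<open>U\<close>
    starts at \<open>a\<close>.\<close>
  define k where "k s = \<Theta> s - \<Theta> a" for s
  have derk: "(k has_real_derivative 1 / V s) (at s)" if "s \<ge> a" for s
    unfolding k_def using DERIV_diff[OF der[OF that] DERIV_const] by simp
  have k_less: "k x < k y" if "a \<le> x" "x < y" for x y
  proof (rule DERIV_pos_imp_increasing[OF that(2)])
    fix z assume "x \<le> z" "z \<le> y"
    then have z: "a \<le> z" using that(1) by simp
    show "\<exists>d. DERIV k z :> d \<and> 0 < d" using derk[OF z] Vpos[OF z] by auto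
  qed
  have contk: "continuous_on {x..y} k" if "x \<ge> a" for x y
    by (rule DERIV_continuous_on[OF has_field_derivative_at_within[OF derk]]) (use that in auto)
  \<comment> \<open>Every time \<open>r\<close> is attained because the travel time is unbounded;
    this makes \<open>U\<close> global.\<close>
  have "\<exists>s\<ge>a. k s = r" if "r \<ge> 0" for r
  proof -
    obtain t where t: "t \<ge> a" "k t > r" using unbdd[of "r + \<Theta> a"] by (auto simp: k_def)
    moreover have "k a \<le> r" using that by (simp add: k_def)
    ultimately show ?thesis using IVT'[of k a r t] contk[of a t] by force
  qed
  then obtain U where U: "\<And>r. r \<ge> 0 \<Longrightarrow> U r \<ge> a" "\<And>r. r \<ge> 0 \<Longrightarrow> k (U r) = r" by metis
  have k_nonneg: "k s \<ge> 0" if "s \<ge> a" for s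
    using k_less[of a s] that by (cases "s = a") (auto simp: k_def)
  have Uk: "U (k s) = s" if "s \<ge> a" for s
    using U[OF k_nonneg[OF that]] k_less[of s "U (k s)"] k_less[of "U (k s)" s] that
    by (cases s "U (k s)" rule: linorder_cases) auto
  have U_mono: "U x \<le> U y" if "0 \<le> x" "x \<le> y" for x y
    using U[of x] U[of y] k_less[of "U y" "U x"] that by force
  have U0: "U 0 = a" using Uk[of a] by (simp add: k_def)
  have admU: "admissible U" using U U_mono by (auto simp: admissible_def mono_on_def)
  have contU: "continuous_on {0..R} U" if "R \<ge> 0" for R
  proof -
    have "continuous_on (k ` {a..U R}) U"
      by (rule continuous_on_inv) (use contk Uk in auto)
    moreover have "{0..R} \<subseteq> k ` {a..U R}"
    proof
      fix r assume "r \<in> {0..R}"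
      then show "r \<in> k ` {a..U R}"
        using U[of r] U_mono[of r R] by (intro image_eqI[of _ _ "U r"]) auto
    qed
    ultimately show ?thesis by (rule continuous_on_subset)
  qed
  have derU: "(U has_real_derivative V (U r)) (at r)" if "r > 0" for r
  proof -
    have "isCont U r"
      using contU[of "r + 1"] that by (intro continuous_on_interior[of "{0..r+1}"]) auto
    then have "(U has_real_derivative inverse (1 / V (U r))) (at r)"
      using U that Vpos[of "U r"]
      by (intro DERIV_inverse_function[where f = k and a = 0 and b = "r + 1"] derk) auto
    then show ?thesis by simp
  qed
  \<comment> \<open>This is \<open>V (U r) powr (p - 1)\<close>, the one-dimensional flux of
    \<open>U\<close>. The choice of \<open>c\<close> makes its derivative exactly
    \<open>f (U r)\<close>.\<close>
  let ?Y = "\<lambda>r. c powr (p - 1) * ?F (U r) powr ((p - 1) / p)"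
  have FU: "?F (U r) > 0" if "r \<ge> 0" for r using U(1)[OF that] a0 by (intro primitive_pos) auto
  have derY: "(?Y has_real_derivative f (U r)) (at r)" if "r > 0" for r
  proof -
    let ?x = "?F (U r)"
    have x: "?x > 0" using FU that by simp
    have dF: "((\<lambda>r. ?F (U r)) has_real_derivative f (U r) * V (U r)) (at r)"
      using U(1)[of r] a0 that by (intro DERIV_chain2[OF DERIV_primitive derU]) auto
    have "(?Y has_real_derivative
        c powr (p - 1) * (((p - 1) / p) * ?x powr ((p - 1) / p - 1) * (f (U r) * V (U r)))) (at r)"
      using DERIV_cmult[OF DERIV_fun_powr[OF dF x, of "(p - 1) / p"], of "c powr (p - 1)"]
      by (simp add: mult_ac)
    moreover have "?x powr ((p - 1) / p - 1) * ?x powr (1 / p) = 1"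
      using x p1 by (simp add: field_simps flip: powr_add)
    moreover have "c powr (p - 1) * c = p / (p - 1)"
      using c powr_add[of c "p - 1" 1] by simp
    moreover have "c powr (p - 1) * (((p - 1) / p) * ?x powr ((p - 1) / p - 1) * (f (U r) * V (U r)))
        = (c powr (p - 1) * c) * ((p - 1) / p) * (?x powr ((p - 1) / p - 1) * ?x powr (1 / p)) * f (U r)"
      by (simp only: V_def mult_ac)
    ultimately show ?thesis using p1 by simp
  qed
  have cont_F: "continuous_on {a..} ?F"
    by (rule DERIV_continuous_on[OF has_field_derivative_at_within[OF DERIV_primitive]]) (use a0 in auto)
  have contFU: "continuous_on {0..R} (\<lambda>r. ?F (U r))" if "R \<ge> 0" for R
    by (rule continuous_on_compose2[OF cont_F contU[OF that]]) (use U in auto)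
  have slope: "mean U s powr q \<le> V (U s)" if s: "s \<ge> 0" for s
  proof -
    \<comment> \<open>The values of \<open>U\<close> at negative arguments are arbitrary, so
      derivatives are available in the interior only, with continuity up to
      \<open>0\<close>.\<close>
    have Y: "((\<lambda>r. f (U r)) has_integral (?Y s - ?Y 0)) {0..s}"
    proof (rule fundamental_theorem_of_calculus_interior[OF s])
      show "continuous_on {0..s} ?Y"
        using FU by (intro continuous_intros contFU s) (auto simp: less_imp_neq[symmetric])
    qed (use derY in \<open>auto simp flip: has_real_derivative_iff_has_vector_derivative\<close>)
    \<comment> \<open>The weight is at most its value at \<open>s\<close>, which the prefactor of
      the mean cancels.\<close>
    have "weighted_integral U s \<le> integral {0..s} (\<lambda>r. s powr (N - 1) * f (U r))"
      unfolding weighted_integral_def using Y N1 f_admissible_pos[OF admU]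
      by (intro integral_le integrable_weight admU integrable_on_mult_right mult_right_mono powr_mono2)
         (auto intro: less_imp_le)
    also have "\<dots> = s powr (N - 1) * (?Y s - ?Y 0)"
      using integral_unique[OF Y] by simp
    finally have "mean U s \<le> s powr (1 - N) * (s powr (N - 1) * (?Y s - ?Y 0))"
      unfolding mean_def by (rule mult_left_mono) simp
    \<comment> \<open>The dropped term \<open>?Y 0\<close> is nonnegative; at \<open>s = 0\<close>
      the left side vanishes since \<open>0 powr (1 - N) = 0\<close>.\<close>
    also have "\<dots> \<le> ?Y s"
      by (cases "s = 0") (auto simp flip: powr_add mult.assoc)
    finally have "mean U s powr q \<le> ?Y s powr q"
      using q_pos mean_nonneg[OF admU s] by (intro powr_mono2) auto
    also have "\<dots> = V (U s)"
      using p1 c(1) by (simp add: V_def powr_mult powr_powr q_def)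
    finally show ?thesis .
  qed
  have "picard U r \<le> U r" if r: "r \<ge> 0" for r
  proof -
    have V: "((\<lambda>s. V (U s)) has_integral (U r - U 0)) {0..r}"
      by (rule fundamental_theorem_of_calculus_interior[OF r contU[OF r]])
         (use derU in \<open>auto simp flip: has_real_derivative_iff_has_vector_derivative\<close>)
    have "integral {0..r} (\<lambda>s. mean U s powr q) \<le> integral {0..r} (\<lambda>s. V (U s))"
      using V slope by (intro integral_le integrable_slope admU) auto
    then show ?thesis using integral_unique[OF V] U0 by (simp add: picard_def)
  qed
  then show ?thesis using admU by blast
qed

section \<open>Fixed points are solutions\<close>

lemma continuous_weight:
  assumes "continuous_on {0..} w"
  shows "continuous_on {0<..} (\<lambda>\<tau>. \<tau> powr (N - 1) * f (w \<tau>))"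
proof -
  have "continuous_on {0<..} w" by (rule continuous_on_subset[OF assms]) auto
  then show ?thesis
    by (intro continuous_intros continuous_on_compose2[OF cont_f[of UNIV]]) auto
qed

lemma fixed_point_derivative:
  assumes "admissible w" "\<And>r. r \<ge> 0 \<Longrightarrow> w r = picard w r" "r \<ge> 0"
  shows "(w has_real_derivative (mean w r powr q)) (at r within {0..})"
  by (rule has_field_derivative_transform_within[OF has_derivative_picard[OF assms(1,3)], of 1])
     (use assms in auto)

text \<open>\<open>phi p\<close> undoes the power \<open>q\<close>, and the two powers of
  \<open>r\<close> cancel. The differential equation then comes from differentiating the weighted
  integral.\<close>

lemma fixed_point_flux:
  assumes "admissible w" "\<And>r. r \<ge> 0 \<Longrightarrow> w r = picard w r" "r > 0"
  shows "flux N p w r = weighted_integral w r"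
proof -
  have "half_deriv w r = mean w r powr q"
    by (rule half_deriv_eq[OF fixed_point_derivative]) (use assms in auto)
  moreover have "phi p (mean w r powr q) = mean w r"
    using p1 mean_nonneg[OF assms(1), of r] assms(3) by (simp add: phi_of_nonneg powr_powr q_def)
  ultimately show ?thesis
    using assms(3) by (simp add: flux_eq_phi mean_def flip: powr_add mult.assoc)
qed

lemma fixed_point_solution:
  assumes "admissible w" "\<And>r. r \<ge> 0 \<Longrightarrow> w r = picard w r"
  shows "radial_solution N p f w" "w 0 = a" "half_deriv w 0 = 0"
proof -
  have der: "(w has_real_derivative mean w r powr q) (at r within {0..})" if "r \<ge> 0" for r
    by (rule fixed_point_derivative[OF assms that])
  have hd: "half_deriv w r = mean w r powr q" if "r \<ge> 0" for r
    by (rule half_deriv_eq[OF der[OF that] that])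
  have cont: "continuous_on {0..} w" by (rule fixed_point_continuous[OF assms])
  have derflux: "(flux N p w has_real_derivative r powr (N - 1) * f (w r)) (at r)" if "r > 0" for r
  proof (rule has_field_derivative_transform_within_open)
    show "(weighted_integral w has_real_derivative r powr (N - 1) * f (w r)) (at r)"
      unfolding weighted_integral_def
      by (rule DERIV_integral_interior[OF that continuous_weight[OF cont] integrable_weight[OF assms(1)]])
  qed (use that fixed_point_flux[OF assms] in \<open>auto intro: open_greaterThan[of 0]\<close>)
  have "C1_half_line w"
    unfolding C1_half_line_def
  proof
    show "w differentiable_on {0..}"
      unfolding differentiable_on_def real_differentiable_def using der by (metis atLeast_iff)
    show "continuous_on {0..} (half_deriv w)"
      by (rule continuous_on_eq[OF continuous_slope[OF assms(1)]]) (simp add: hd)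
  qed
  moreover have "flux N p w C1_differentiable_on {0<..}"
    unfolding C1_differentiable_on_def
    using derflux continuous_weight[OF cont]
    by (intro exI[of _ "\<lambda>r. r powr (N - 1) * f (w r)"])
       (auto simp flip: has_real_derivative_iff_has_vector_derivative)
  ultimately show "radial_solution N p f w"
    unfolding radial_solution_def using DERIV_imp_deriv[OF derflux] by simp
  show "w 0 = a" using assms(2)[of 0] by (simp add: picard_def)
  show "half_deriv w 0 = 0" using hd[of 0] by (simp add: mean_at_0)
qed

section \<open>Solutions are admissible fixed points\<close>

lemma solution_fixed_point:
  assumes sol: "radial_solution N p f v" and v0: "v 0 = a" and d0: "half_deriv v 0 = 0"
  shows "admissible v \<and> (\<forall>r\<ge>0. v r = picard v r)"
proof -
  define d where "d = half_deriv v"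
  have der: "(v has_real_derivative d r) (at r within {0..})" if "r \<ge> 0" for r
    using sol that vector_derivative_works[of v "at r within {0..}"]
    by (simp add: radial_solution_def C1_half_line_def differentiable_on_def d_def half_deriv_def
        has_real_derivative_iff_has_vector_derivative)
  have contd: "continuous_on {0..} d"
    using sol by (simp add: radial_solution_def C1_half_line_def d_def)
  have contv: "continuous_on {0..} v" by (rule DERIV_continuous_on[OF der]) auto
  have flux: "flux N p v r = r powr (N - 1) * phi p (d r)" for r by (simp add: flux_eq_phi d_def)
  \<comment> \<open>The equation is stated with \<open>deriv\<close>, which has a meaning only where
    a derivative exists; the C1 condition on the flux supplies one.\<close>
  have derflux: "(flux N p v has_real_derivative r powr (N - 1) * f (v r)) (at r)" if "r > 0" for r
  proof -
    obtain D where "\<And>x. x \<in> {0<..} \<Longrightarrow> (flux N p v has_vector_derivative D x) (at x)"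
      using sol unfolding radial_solution_def C1_differentiable_on_def by blast
    then have "(flux N p v has_real_derivative D r) (at r)"
      using that by (simp add: has_real_derivative_iff_has_vector_derivative)
    moreover have "deriv (flux N p v) r = r powr (N - 1) * f (v r)"
      using sol that by (simp add: radial_solution_def)
    ultimately show ?thesis using DERIV_imp_deriv by metis
  qed
  have flux0: "flux N p v 0 = 0" by (simp add: flux)
  have contflux: "continuous_on {0..R} (flux N p v)" for R
  proof -
    have "continuous (at r within {0..R}) (flux N p v)" if "r \<in> {0..R}" for r
    proof (cases "r = 0")
      case False
      then show ?thesis
        using derflux[of r] that by (auto intro: continuous_at_imp_continuous_at_within DERIV_isCont)
    next
      case True
      have "(d \<longlongrightarrow> 0) (at 0 within {0..})"
        using contd[unfolded continuous_on_def, rule_format, of 0] d0 by (simp add: d_def)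
      then have "(d \<longlongrightarrow> 0) (at 0 within {0..R})"
        by (rule tendsto_within_subset) auto
      then have lim: "((\<lambda>x. \<bar>d x\<bar> powr (p - 1)) \<longlongrightarrow> 0) (at 0 within {0..R})"
        using p1 tendsto_powr'[of "\<lambda>x. \<bar>d x\<bar>" 0 _ "\<lambda>_. p - 1" "p - 1"] tendsto_rabs[of d 0] by simp
      \<comment> \<open>Near \<open>0\<close> the weight is at most \<open>1\<close>, so the flux is
        dominated by a positive power of \<open>\<bar>d x\<bar>\<close>, which tends to
        \<open>0\<close>.\<close>
      have "norm (flux N p v x) \<le> \<bar>d x\<bar> powr (p - 1)" if "x \<ge> 0" "x < 1" for x
      proof -
        have "x powr (N - 1) \<le> 1" using powr_mono2[of "N - 1" x 1] that N1 by simp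
        moreover have "\<bar>phi p (d x)\<bar> \<le> \<bar>d x\<bar> powr (p - 1)"
          using p1 by (simp add: phi_eq_sgn_powr abs_mult abs_sgn_eq)
        ultimately show ?thesis
          using mult_mono[of "x powr (N - 1)" 1 "\<bar>phi p (d x)\<bar>" "\<bar>d x\<bar> powr (p - 1)"]
          by (simp add: flux abs_mult)
      qed
      then have "\<forall>\<^sub>F x in at 0 within {0..R}. norm (flux N p v x) \<le> \<bar>d x\<bar> powr (p - 1)"
        by (auto simp: eventually_at dist_real_def intro!: exI[of _ 1])
      from Lim_null_comparison[OF this lim] show ?thesis
        by (simp add: continuous_within True flux0)
    qed
    then show ?thesis by (simp add: continuous_on_eq_continuous_within)
  qed
  have fluxint: "((\<lambda>\<tau>. \<tau> powr (N - 1) * f (v \<tau>)) has_integral flux N p v r) {0..r}" if "r \<ge> 0" for r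
    using fundamental_theorem_of_calculus_interior[OF that contflux[of r],
        of "\<lambda>\<tau>. \<tau> powr (N - 1) * f (v \<tau>)"] derflux flux0
    by (auto simp flip: has_real_derivative_iff_has_vector_derivative)
  have vint: "(d has_integral v y - v x) {x..y}" if "0 \<le> x" "x \<le> y" for x y
  proof (rule fundamental_theorem_of_calculus[OF that(2)])
    fix t assume "t \<in> {x..y}"
    then show "(v has_vector_derivative d t) (at t within {x..y})"
      unfolding has_real_derivative_iff_has_vector_derivative[symmetric]
      by (intro DERIV_subset[OF der]) (use that in auto)
  qed
  \<comment> \<open>As long as \<open>v\<close> stays nonnegative, the flux is the integral of a
    nonnegative function, and \<open>phi\<close> preserves signs.\<close>
  have d_nonneg: "d r \<ge> 0" if "r \<ge> 0" "\<And>\<tau>. 0 \<le> \<tau> \<Longrightarrow> \<tau> \<le> r \<Longrightarrow> v \<tau> \<ge> 0" for r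
  proof (cases "r = 0")
    case False
    have "flux N p v r \<ge> 0"
      by (rule has_integral_nonneg[OF fluxint[OF that(1)]]) (use that f_nonneg in auto)
    moreover have "r powr (N - 1) > 0" using False by simp
    ultimately have "phi p (d r) \<ge> 0" by (simp add: flux zero_le_mult_iff)
    then show ?thesis using p1 by (auto simp: phi_eq_sgn_powr zero_le_mult_iff sgn_if split: if_splits)
  qed (simp add: d_def d0)
  have ge_a: "v R \<ge> a" if "R \<ge> 0" "\<And>\<tau>. 0 \<le> \<tau> \<Longrightarrow> \<tau> \<le> R \<Longrightarrow> v \<tau> \<ge> 0" for R
  proof -
    have "v R - v 0 \<ge> 0"
      by (rule has_integral_nonneg[OF vint]) (use that d_nonneg in auto)
    then show ?thesis by (simp add: v0)
  qed
  \<comment> \<open>Otherwise there is a first point \<open>Inf C\<close> with a nonpositive value.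
    Before it \<open>v\<close> would pass through \<open>a / 2\<close>, although \<open>ge_a\<close>
    keeps it at or above \<open>a\<close> there.\<close>
  have v_pos: "v r > 0" if "r \<ge> 0" for r
  proof (rule ccontr)
    assume neg: "\<not> v r > 0"
    define C where "C = {r \<in> {0..}. v r \<le> 0}"
    have "closed C"
      unfolding C_def by (intro continuous_on_closed_Collect_le contv continuous_intros)
    moreover have "C \<noteq> {}" "bdd_below C" using neg that by (auto simp: C_def)
    ultimately have r0: "Inf C \<in> C" by (intro closed_contains_Inf)
    have before: "v \<tau> > 0" if "0 \<le> \<tau>" "\<tau> < Inf C" for \<tau>
      using cInf_lower[OF _ \<open>bdd_below C\<close>, of \<tau>] that by (cases "\<tau> \<in> C") (auto simp: C_def)
    have "\<exists>x\<ge>0. x \<le> Inf C \<and> v x = a / 2"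
      using IVT2'[of v "Inf C" "a / 2" 0] r0 v0 a0 continuous_on_subset[OF contv, of "{0..Inf C}"]
      by (auto simp: C_def)
    then obtain x where x: "x \<ge> 0" "x \<le> Inf C" "v x = a / 2" by blast
    moreover have "x \<noteq> Inf C" using x(3) r0 a0 by (auto simp: C_def)
    ultimately have "v x \<ge> a" using before by (intro ge_a) (auto simp: less_imp_le)
    then show False using x(3) a0 by simp
  qed
  have d_nonneg': "d r \<ge> 0" if "r \<ge> 0" for r
    using d_nonneg[OF that] v_pos by (simp add: less_imp_le)
  have "v x \<le> v y" if "0 \<le> x" "x \<le> y" for x y
    using has_integral_nonneg[OF vint[OF that]] d_nonneg' that by force
  then have admissible: "admissible v" using v0 unfolding admissible_def mono_on_def by (metis atLeast_iff order_refl)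
  have slope: "mean v r powr q = d r" if "r \<ge> 0" for r
  proof (cases "r = 0")
    case False
    have "weighted_integral v r = flux N p v r" unfolding weighted_integral_def by (rule integral_unique[OF fluxint[OF that]])
    then have "mean v r = d r powr (p - 1)"
      using False that p1 d_nonneg'[OF that]
      by (simp add: mean_def flux phi_of_nonneg flip: powr_add mult.assoc)
    then show ?thesis using p1 d_nonneg'[OF that] by (simp add: powr_powr q_def)
  qed (simp add: mean_at_0 d_def d0)
  have "v r = picard v r" if "r \<ge> 0" for r
  proof -
    have "integral {0..r} (\<lambda>s. mean v s powr q) = integral {0..r} d"
      by (rule integral_cong) (simp add: slope)
    then show ?thesis using integral_unique[OF vint[of 0 r]] that v0 by (simp add: picard_def)
  qed
  then show ?thesis using admissible by blast
qed

section \<open>The integral formula and the conclusion\<close>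

text \<open>Both nested integrands are continuous and bounded in the open interval, so each interval
  integral becomes a gauge integral; on the nonnegative means \<open>H p\<close> is the power
  \<open>q\<close>.\<close>

lemma picard_eq_interval_integral:
  assumes "admissible w" "continuous_on {0..} w" "r \<ge> 0"
  shows "picard w r = a + (LBINT s=0..ereal r.
    H p (s powr (1 - N) * (LBINT \<tau>=0..ereal s. \<tau> powr (N - 1) * f (w \<tau>))))"
proof -
  have inner: "(LBINT \<tau>=0..ereal s. \<tau> powr (N - 1) * f (w \<tau>)) = weighted_integral w s" if "s \<ge> 0" for s
    unfolding weighted_integral_def
  proof (rule interval_lebesgue_integral_eq_integral[OF that])
    show "continuous_on {0<..<s} (\<lambda>\<tau>. \<tau> powr (N - 1) * f (w \<tau>))"
      by (rule continuous_on_subset[OF continuous_weight[OF assms(2)]]) auto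
    show "\<bar>x powr (N - 1) * f (w x)\<bar> \<le> s powr (N - 1) * f (w s)" if "x \<in> {0<..<s}" for x
      using that f_admissible_pos[OF assms(1), of x] f_admissible_mono[OF assms(1), of x s] N1
      by (auto simp: abs_mult intro!: mult_mono powr_mono2)
  qed
  let ?h = "\<lambda>s. H p (s powr (1 - N) * (LBINT \<tau>=0..ereal s. \<tau> powr (N - 1) * f (w \<tau>)))"
  have h: "?h s = mean w s powr q" if "s \<ge> 0" for s
    using H_of_nonneg[OF p1 mean_nonneg[OF assms(1) that]] inner[OF that]
    by (simp add: mean_def q_def)
  have "(LBINT s=0..ereal r. ?h s) = integral {0..r} ?h"
  proof (rule interval_lebesgue_integral_eq_integral[OF assms(3)])
    show "continuous_on {0<..<r} ?h"
      by (rule continuous_on_eq[OF continuous_on_subset[OF continuous_slope[OF assms(1)]]])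
         (auto simp: h)
    show "\<bar>?h x\<bar> \<le> (r * f (w r)) powr q" if "x \<in> {0<..<r}" for x
    proof -
      have "mean w x \<le> x * f (w x)" using mean_upper[OF assms(1)] that by simp
      also have "\<dots> \<le> r * f (w r)"
        using that f_admissible_pos[OF assms(1), of x] f_admissible_mono[OF assms(1), of x r]
        by (intro mult_mono) auto
      finally show ?thesis
        using that q_pos mean_nonneg[OF assms(1), of x] by (simp add: h powr_mono2)
    qed
  qed
  also have "\<dots> = integral {0..r} (\<lambda>s. mean w s powr q)"
    by (rule integral_cong) (simp add: h)
  finally show ?thesis by (simp add: picard_def)
qed

end

theorem theorem1p5:
  fixes N p a :: real and f :: "real \<Rightarrow> real"
  assumes "N \<ge> 1" and "p > 1"
    and "mono f"
    and "local_lipschitz (UNIV :: real set) UNIV (\<lambda>_. f)"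
    and "\<And>s. f s = 0 \<longleftrightarrow> s = 0"
    and "(\<integral>\<^sup>+s\<in>{1..}. ennreal (1 / primitive f s powr (1 / p)) \<partial>lborel) = \<infinity>"
    and "a > 0"
  shows "\<exists>w. (radial_solution N p f w \<and> w 0 = a \<and> half_deriv w 0 = 0) \<and>
    (\<forall>v. radial_solution N p f v \<and> v 0 = a \<and> half_deriv v 0 = 0 \<longrightarrow> (\<forall>r\<ge>0. v r = w r)) \<and>
    (\<forall>r\<ge>0. w r = a + (LBINT s=0..ereal r.
        H p (s powr (1 - N) * (LBINT \<tau>=0..ereal s. \<tau> powr (N - 1) * f (w \<tau>)))))"
proof -
  interpret radial_data N p a f by unfold_locales (use assms in auto)
  obtain U where "admissible U" "\<And>r. r \<ge> 0 \<Longrightarrow> picard U r \<le> U r"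
    using ex_supersolution[OF assms(6)] by blast
  then obtain w where w: "admissible w" "\<And>r. r \<ge> 0 \<Longrightarrow> w r = picard w r"
    using ex_fixed_point by blast
  show ?thesis
  proof (intro exI[of _ w] conjI allI impI)
    fix v r assume "radial_solution N p f v \<and> v 0 = a \<and> half_deriv v 0 = 0" and r: "(r::real) \<ge> 0"
    then have "admissible v \<and> (\<forall>r\<ge>0. v r = picard v r)" by (intro solution_fixed_point) auto
    then show "v r = w r" using fixed_point_unique[of v w r] w r by blast
  next
    fix r :: real assume r: "r \<ge> 0"
    show "w r = a + (LBINT s=0..ereal r.
        H p (s powr (1 - N) * (LBINT \<tau>=0..ereal s. \<tau> powr (N - 1) * f (w \<tau>))))"
      using picard_eq_interval_integral[OF w(1) fixed_point_continuous[OF w] r] w(2)[OF r] by simp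
  qed (use fixed_point_solution[OF w] in auto)
qed

end
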